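(* Let $\mathcal{G}$ be the Sprague–Grundy function of Exco-Nim with $n=2$. Let $x=(x_0,x_1,x_2)$ be a position with $x_1\le x_2$ and $\mathcal{G}(x)=v$, where $v$ is a positive integer, and let $k=k(v)$ be the unique integer with $2^{k-1}\le v<2^{k}$. Then there exist a position $\hat x=(\hat x_0,\hat x_1,\hat x_2)$ with $\hat x_0\le v$, $\hat x_1\le 2^{k-1}-1$, $\hat x_2\le 2^{k}-1$ and $\mathcal{G}(\hat x)=\mathcal{G}(x)$, and a nonnegative integer $\lambda$, such that $x=\hat x+\lambda\,(0,2^{k},2^{k})$.
   Context: Exco-Nim with $n=2$: positions are triples $x=(x_0,x_1,x_2)$ of nonnegative integers. A legal move $x\to x'$ is to a triple $x'$ of nonnegative integers with $x'_j\le x_j$ for $j=0,1,2$, $x'_0+x'_1+x'_2<x_0+x_1+x_2$, and $x'_1=x_1$ or $x'_2=x_2$. The Sprague–Grundy function is $\mathcal{G}(x)=\operatorname{mex}\{\mathcal{G}(x'): x\to x'\}$, where $\operatorname{mex}(S)$ is the least nonnegative integer not in $S$. *)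

theory Defs
  imports Main
begin

type_synonym position = "nat \<times> nat \<times> nat"

fun exco_move :: "position \<Rightarrow> position \<Rightarrow> bool" where
  "exco_move (x0, x1, x2) (y0, y1, y2) \<longleftrightarrow>
     y0 \<le> x0 \<and> y1 \<le> x1 \<and> y2 \<le> x2 \<and>
     y0 + y1 + y2 < x0 + x1 + x2 \<and>
     (y1 = x1 \<or> y2 = x2)"

definition mex :: "nat set \<Rightarrow> nat" where
  "mex S = (LEAST n. n \<notin> S)"

function grundy :: "position \<Rightarrow> nat" where
  "grundy x = mex (grundy ` {y. exco_move x y})"
  by auto
termination
  by (relation "measure (\<lambda>(x0, x1, x2). x0 + x1 + x2)") auto

declare grundy.simps [simp del]

text \<open>Every position has finitely many options, so the set whose \<^const>\<open>mex\<close> is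
  taken is finite and the \<open>LEAST\<close> is attained.\<close>

lemma finite_exco_moves: "finite {y. exco_move x y}"
proof (cases x)
  case (fields x0 x1 x2)
  have "{y. exco_move x y} \<subseteq> {..x0} \<times> {..x1} \<times> {..x2}"
    using fields by auto
  then show ?thesis
    by (rule finite_subset) auto
qed

lemma mex_notin: "finite S \<Longrightarrow> mex S \<notin> S"
  unfolding mex_def by (rule LeastI_ex) (rule ex_new_if_finite[OF infinite_UNIV_nat])

end

theory Submission
  imports Defs
begin

text \<open>
  For \<open>x\<^sub>0 = 0\<close> the game is two-pile Nim, and the value strictly increases with \<open>x\<^sub>0\<close>.
  Hence a value below \<open>B = 2\<^sup>k\<close> forces \<open>x\<^sub>1\<close> and \<open>x\<^sub>2\<close> into the same block
  \<open>[lB, (l + 1)B)\<close>: in different blocks already the Nim sum is at least \<open>B\<close>. In particular,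
  options leaving the block do not influence whether a value below \<open>B\<close> is attained, which makes
  such values invariant under the shift by \<open>(0, B, B)\<close>. Finally, if
  \<open>2\<^sup>k\<^sup>-\<^sup>1 \<le> v < 2\<^sup>k\<close> and both \<open>x\<^sub>1\<close> and \<open>x\<^sub>2\<close> lay in the upper half of the block \<open>l = 0\<close>,
  the position would have the option \<open>(0, x\<^sub>1, x\<^sub>1 XOR v)\<close>, whose value is \<open>v\<close>.
\<close>

unbundle bit_operations_syntax

lemma ex_move_of_less_grundy:
  assumes "w < grundy x"
  shows "\<exists>y. exco_move x y \<and> grundy y = w"
proof -
  have "w < (LEAST n. n \<notin> grundy ` {y. exco_move x y})"
    using assms by (subst (asm) grundy.simps) (simp add: mex_def)
  from not_less_Least[OF this] show ?thesis by auto
qed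

lemma grundy_move_neq:
  assumes "exco_move x y"
  shows "grundy y \<noteq> grundy x"
proof -
  have "grundy x \<notin> grundy ` {y. exco_move x y}"
    using mex_notin[OF finite_imageI[OF finite_exco_moves]] by (subst (1) grundy.simps)
  with assms show ?thesis by (metis imageI mem_Collect_eq)
qed

text \<open>Only option values up to \<open>v\<close> matter here, so two positions can be compared
  by their small option values alone.\<close>

lemma grundy_eq_iff:
  "grundy x = v \<longleftrightarrow>
     (\<forall>w<v. \<exists>y. exco_move x y \<and> grundy y = w) \<and> \<not> (\<exists>y. exco_move x y \<and> grundy y = v)"
  using ex_move_of_less_grundy grundy_move_neq by (metis linorder_neqE_nat)

text \<open>Every option of \<open>(x0, a, b)\<close> is an option of \<open>(Suc x0, a, b)\<close>,
  and so is \<open>(x0, a, b)\<close> itself; hence each unit added to \<open>x0\<close> strictly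
  raises the value.\<close>

lemma grundy_ge:
  "grundy (0, a, b) + x0 \<le> grundy (x0, a, b)"
proof (induction x0)
  case (Suc x0)
  have "grundy (x0, a, b) < grundy (Suc x0, a, b)"
  proof (rule ccontr)
    assume "\<not> ?thesis"
    moreover have "grundy (x0, a, b) \<noteq> grundy (Suc x0, a, b)"
      by (rule grundy_move_neq) simp
    ultimately have "grundy (Suc x0, a, b) < grundy (x0, a, b)"
      by simp
    then obtain y where y: "exco_move (x0, a, b) y" "grundy y = grundy (Suc x0, a, b)"
      using ex_move_of_less_grundy by blast
    then have "exco_move (Suc x0, a, b) y"
      by (cases y) auto
    with y(2) grundy_move_neq show False by blast
  qed
  with Suc show ?case by simp
qed simp

lemma xor_nat_left_cancel: "a XOR (a XOR b) = (b :: nat)"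
  by (simp flip: xor.assoc)

text \<open>Supplies the Nim move that reaches value \<open>w\<close>. The induction strips the last
  binary digit: a strict inequality is decided by the halves or, if these tie, by parity.\<close>

lemma less_xor_cases:
  fixes a b w :: nat
  assumes "w < a XOR b"
  shows "w XOR b < a \<or> w XOR a < b"
  using assms
proof (induction a arbitrary: b w rule: less_induct)
  case (less a)
  show ?case
  proof (cases "a = 0")
    case True
    with less.prems show ?thesis by simp
  next
    case False
    have half: "(m XOR n) div 2 = (m div 2) XOR (n div 2)" for m n :: nat
      using drop_bit_xor[of 1 m n] by (simp add: drop_bit_eq_div)
    have parity: "odd (m XOR n) \<longleftrightarrow> odd m \<noteq> odd n" for m n :: nat
      by (simp add: even_xor_iff)
    have less_iff: "m < n \<longleftrightarrow> m div 2 < n div 2 \<or> m div 2 = n div 2 \<and> even m \<and> odd n"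
      for m n :: nat
      by presburger
    from less.prems consider
        "w div 2 < (a div 2) XOR (b div 2)"
      | "w div 2 = (a div 2) XOR (b div 2)" "even w" "odd a \<noteq> odd b"
      using less_iff[of w "a XOR b"] by (auto simp: half parity)
    then show ?thesis
    proof cases
      case 1
      with less.IH[of "a div 2" "w div 2" "b div 2"] False show ?thesis
        using less_iff[of "w XOR b" a] less_iff[of "w XOR a" b] by (auto simp: half)
    next
      \<comment> \<open>The halves tie and \<open>w\<close> is even, so the odd one of
        \<open>a\<close> and \<open>b\<close> is the pile that can be lowered.\<close>
      case 2
      have "w div 2 XOR b div 2 = a div 2" "w div 2 XOR a div 2 = b div 2"
        using 2(1) by (simp_all add: xor.assoc xor.commute[of _ "a div 2"] xor_nat_left_cancel)
      with 2 show ?thesis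
        using less_iff[of "w XOR b" a] less_iff[of "w XOR a" b] by (auto simp: half parity)
    qed
  qed
qed

lemma grundy_0: "grundy (0, a, b) = a XOR b"
proof (induction "a + b" arbitrary: a b rule: less_induct)
  case less
  have "\<exists>y. exco_move (0, a, b) y \<and> grundy y = w" if "w < a XOR b" for w
    using less_xor_cases[OF that]
  proof
    assume *: "w XOR b < a"
    then have "grundy (0, w XOR b, b) = w"
      using less[of "w XOR b" b] by (simp add: xor.assoc)
    with * show ?thesis by (intro exI[of _ "(0, w XOR b, b)"]) simp
  next
    assume *: "w XOR a < b"
    then have "grundy (0, a, w XOR a) = w"
      using less[of a "w XOR a"] by (simp add: xor.commute[of w] xor_nat_left_cancel)
    with * show ?thesis by (intro exI[of _ "(0, a, w XOR a)"]) simp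
  qed
  moreover have "grundy y \<noteq> a XOR b" if "exco_move (0, a, b) y" for y
  proof -
    obtain y0 c d where "y = (y0, c, d)"
      by (rule prod_cases3)
    with that have y: "y = (0, c, d)" and cd: "c + d < a + b" "c = a \<or> d = b"
      by auto
    have "c XOR d \<noteq> a XOR b"
      using cd xor_nat_left_cancel[of a b] xor_nat_left_cancel[of a d]
        xor_nat_left_cancel[of b a] xor_nat_left_cancel[of b c]
      by (auto simp: xor.commute)
    with less[OF cd(1)] y show ?thesis by simp
  qed
  ultimately show ?case by (subst grundy_eq_iff) blast
qed

lemma xor_div_power: "(a XOR b) div 2 ^ k = (a div 2 ^ k) XOR (b div 2 ^ k)" for a b :: nat
  using drop_bit_xor[of k a b] by (simp add: drop_bit_eq_div)

lemma same_block_of_grundy_less: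
  assumes "grundy (x0, a, b) < 2 ^ k"
  shows "a div 2 ^ k = b div 2 ^ k"
proof -
  have "a XOR b < 2 ^ k"
    using assms grundy_ge[of a b x0] by (simp add: grundy_0)
  then have "(a div 2 ^ k) XOR (b div 2 ^ k) = 0"
    by (simp flip: xor_div_power)
  then show ?thesis
    using xor_nat_left_cancel[of "a div 2 ^ k" "b div 2 ^ k"] by simp
qed

text \<open>Stated for each single \<open>w\<close> below \<open>2 ^ k\<close> because larger values
  may change under the shift.\<close>

lemma grundy_shift_iff:
  assumes "a < 2 ^ k" "b < 2 ^ k" "w < 2 ^ k"
  shows "grundy (x0, l * 2 ^ k + a, l * 2 ^ k + b) = w \<longleftrightarrow> grundy (x0, a, b) = w"
  using assms
proof (induction "x0 + a + b" arbitrary: x0 a b w rule: less_induct)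
  case less
  let ?L = "l * 2 ^ k"
  have "(\<exists>y. exco_move (x0, ?L + a, ?L + b) y \<and> grundy y = u) \<longleftrightarrow>
        (\<exists>y. exco_move (x0, a, b) y \<and> grundy y = u)" (is "?S \<longleftrightarrow> ?T")
    if u: "u < 2 ^ k" for u
  proof
    assume ?S
    then obtain y0 y1 y2
      where mv: "exco_move (x0, ?L + a, ?L + b) (y0, y1, y2)" and g: "grundy (y0, y1, y2) = u"
      by (metis prod_cases3)
    have same: "y1 div 2 ^ k = y2 div 2 ^ k"
      using same_block_of_grundy_less g u by blast
    have "(?L + a) div 2 ^ k = l" "(?L + b) div 2 ^ k = l"
      using less.prems by simp_all
    \<comment> \<open>A move keeps one of the two piles, which pins their common block to
      \<open>l\<close>.\<close>
    with mv same have "y1 div 2 ^ k = l" "y2 div 2 ^ k = l"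
      by auto
    then obtain c d where y: "y1 = ?L + c" "y2 = ?L + d" and cd: "c < 2 ^ k" "d < 2 ^ k"
      by (metis div_mult_mod_eq mod_less_divisor zero_less_numeral zero_less_power)
    have "exco_move (x0, a, b) (y0, c, d)"
      using mv y by auto
    moreover from this have "grundy (y0, c, d) = u"
      using less.hyps[of y0 c d u] cd u g y by auto
    ultimately show ?T by blast
  next
    assume ?T
    then obtain y0 c d
      where mv: "exco_move (x0, a, b) (y0, c, d)" and g: "grundy (y0, c, d) = u"
      by (metis prod_cases3)
    then have "grundy (y0, ?L + c, ?L + d) = u"
      using less.hyps[of y0 c d u] less.prems u by auto
    moreover have "exco_move (x0, ?L + a, ?L + b) (y0, ?L + c, ?L + d)"
      using mv by auto
    ultimately show ?S by blast
  qed
  with less.prems(3) show ?case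
    using grundy_eq_iff[of "(x0, ?L + a, ?L + b)" w] grundy_eq_iff[of "(x0, a, b)" w]
    by (meson less_trans)
qed

lemma grundy_neq_of_upper_half:
  assumes "2 ^ n \<le> a" "a < 2 ^ Suc n" "2 ^ n \<le> b" "2 ^ n \<le> v" "v < 2 ^ Suc n"
  shows "grundy (x0, a, b) \<noteq> v"
proof -
  \<comment> \<open>Both \<open>a\<close> and \<open>v\<close> have leading bit
    \<open>2 ^ n\<close>. It cancels in \<open>a XOR v\<close>, which therefore lies below
    \<open>b\<close>.\<close>
  have "a div 2 ^ n = 1" "v div 2 ^ n = 1"
    using assms by (simp_all add: div_nat_eqI)
  then have "(a XOR v) div 2 ^ n = 0"
    by (simp add: xor_div_power)
  then have "a XOR v < 2 ^ n"
    by (simp add: div_eq_0_iff)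
  then have "exco_move (x0, a, b) (0, a, a XOR v)"
    using assms by simp
  moreover have "grundy (0, a, a XOR v) = v"
    by (simp add: grundy_0 xor_nat_left_cancel)
  ultimately show ?thesis
    using grundy_move_neq by blast
qed

theorem theorem4p5:
  fixes x0 x1 x2 v k :: nat
  assumes "x1 \<le> x2"
    and "grundy (x0, x1, x2) = v"
    and "v > 0"
    and "k \<ge> 1" and "2 ^ (k - 1) \<le> v" and "v < 2 ^ k"
  shows "\<exists>y0 y1 y2 l :: nat.
           y0 \<le> v \<and> y1 \<le> 2 ^ (k - 1) - 1 \<and> y2 \<le> 2 ^ k - 1 \<and>
           grundy (y0, y1, y2) = grundy (x0, x1, x2) \<and>
           (x0, x1, x2) = (y0, y1 + l * 2 ^ k, y2 + l * 2 ^ k)"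
proof -
  define l y1 y2 where "l = x1 div 2 ^ k" and "y1 = x1 mod 2 ^ k" and "y2 = x2 mod 2 ^ k"
  have "x2 div 2 ^ k = l"
    using same_block_of_grundy_less[of x0 x1 x2 k] assms l_def by simp
  then have x: "x1 = l * 2 ^ k + y1" "x2 = l * 2 ^ k + y2"
    unfolding l_def y1_def y2_def by (metis div_mult_mod_eq)+
  have y: "y1 < 2 ^ k" "y2 < 2 ^ k"
    by (simp_all add: y1_def y2_def)
  have g: "grundy (x0, y1, y2) = v"
    using grundy_shift_iff[OF y \<open>v < 2 ^ k\<close>, of x0 l] assms(2) x by simp
  \<comment> \<open>By this ordering, \<open>y1\<close> in the upper half would put
    \<open>y2\<close> there too.\<close>
  have "y1 \<le> y2"
    using assms(1) x by simp
  then have "y1 < 2 ^ (k - 1)"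
    using grundy_neq_of_upper_half[of "k - 1" y1 y2 v x0] g assms y(1)
    by (cases "y1 < 2 ^ (k - 1)") auto
  moreover have "x0 \<le> v"
    using grundy_ge[of x1 x2 x0] assms(2) by simp
  ultimately show ?thesis
    using g assms(2) x y by (intro exI[of _ x0] exI[of _ y1] exI[of _ y2] exI[of _ l]) auto
qed

end
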